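(* Let $\langle S,\leq_S\rangle$ be a directed partial order with a minimum element, and let $\lambda$ be a cardinal. If there is a $\lambda$-dominating system on $S$, then $\mathcal{SN}\preceq_{\mathrm{T}}\mathbf{D}_S^\lambda$, where $\mathcal{SN}$ is viewed as the relational system $\langle\mathcal{SN},\mathcal{SN},\subseteq\rangle$.
   Context: A relational system is a triple $\mathbf{R}=\langle X,Y,R\rangle$ with $R\subseteq X\times Y$; $\mathfrak{b}(\mathbf{R})$ is the least size of an $E\subseteq X$ with no $y\in Y$ such that $xRy$ for all $x\in E$, and $\mathfrak{d}(\mathbf{R})$ is the least size of a $D\subseteq Y$ with $\forall x\in X\exists y\in D\,(xRy)$. For relational systems $\mathbf{R}=\langle X,Y,R\rangle$, $\mathbf{R}'=\langle X',Y',R'\rangle$, $\mathbf{R}\preceq_{\mathrm{T}}\mathbf{R}'$ (Tukey below) means there are maps $\Psi_1:X\to X'$, $\Psi_2:Y'\to Y$ such that for all $x\in X$, $y'\in Y'$, $\Psi_1(x)R'y'$ implies $xR\Psi_2(y')$. For a directed partial order $\langle S,\leq_S\rangle$ and a cardinal $\lambda$, $\mathbf{D}_S^\lambda=\langle S^\lambda,S^\lambda,\leq\rangle$ where $X\leq Y$ iff $X(\alpha)\leq_S Y(\alpha)$ for all $\alpha<\lambda$. Strong measure zero: $X\subseteq 2^\omega$ has strong measure zero iff for every $f\in\omega^\omega$ there is $\sigma\in(2^{<\omega})^\omega$ with $|\sigma(n)|=f(n)$ for all $n$ and $X\subseteq\bigcup_{n<\omega}[\sigma(n)]$ (here $[s]=\{x\in2^\omega: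 s\subseteq x\}$). $\mathcal{SN}$ is the family of strong measure zero subsets of $2^\omega$. Yorioka ideals: for $\sigma\in(2^{<\omega})^\omega$ let $\mathrm{ht}_\sigma(i)=|\sigma(i)|$ and $[\sigma]_\infty=\{x\in2^\omega:\exists^\infty n\,(\sigma(n)\subseteq x)\}$. Let $\mathrm{pw}_k(i)=i^k$ and for $f,g\in\omega^\omega$ write $f\ll g$ iff for every $k<\omega$, $f\circ\mathrm{pw}_k\leq^* g$ (eventual domination). For increasing $f\in\omega^\omega$, $\mathcal{I}_f=\{X\subseteq2^\omega:\exists\sigma\in(2^{<\omega})^\omega\,(X\subseteq[\sigma]_\infty\text{ and } f\ll\mathrm{ht}_\sigma)\}$. For increasing $f\in\omega^\omega$ and a directed partial order $S$, an $\mathcal{I}_f$ directed system on $S$ is a family $\langle A_i^f: i\in S\rangle$ of subsets of $2^\omega$ such that (I) each $A_i^f$ is a dense $G_\delta$ subset of $2^\omega$ and $A_i^f\in\mathcal{I}_f$; (II) $i\leq_S j$ implies $A_i^f\subseteq A_j^f$; (III) every member of $\mathcal{I}_f$ is contained in some $A_i^f$. If $S$ has minimum $i_0$ and $\lambda$ is a cardinal, a $\lambda$-dominating system on $S$ is a family $\langle A^{f_\gamma}:\gamma<\lambda\rangle$ where $\{f_\gamma:\gamma<\lambda\}$ is a dominating family (w.r.t. $\leq^*$) of increasing functions in $\omega^\omega$, each $A^{f_\gamma}=\langle A_i^{f_\gamma}:i\in S\rangle$ is an $\mathcal{I}_{f_\gamma}$ directed system on $S$, and for every $\gamma<\lambda$,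 $\bigcap_{\eta<\gamma}A_{i_0}^{f_\eta}\notin\mathcal{I}_{f_\gamma}$ (the empty intersection being $2^\omega$). *)

theory Defs
  imports "HOL-Analysis.Analysis"
begin

section \<open>Relational systems and the Tukey order\<close>

record ('x, 'y) relational_system =
  rs_dom :: "'x set"
  rs_cod :: "'y set"
  rs_rel :: "('x \<times> 'y) set"

definition tukey_below ::
    "('x, 'y) relational_system \<Rightarrow> ('u, 'v) relational_system \<Rightarrow> bool" (infix \<open>\<preceq>\<^sub>T\<close> 50) where
  "R \<preceq>\<^sub>T R' \<longleftrightarrow>
     (\<exists>\<Psi>1 \<Psi>2. \<Psi>1 \<in> rs_dom R \<rightarrow> rs_dom R' \<and> \<Psi>2 \<in> rs_cod R' \<rightarrow> rs_cod R \<and>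
       (\<forall>x\<in>rs_dom R. \<forall>y'\<in>rs_cod R'. (\<Psi>1 x, y') \<in> rs_rel R' \<longrightarrow> (x, \<Psi>2 y') \<in> rs_rel R))"

definition directed_partial_order :: "'s set \<Rightarrow> 's rel \<Rightarrow> bool" where
  "directed_partial_order S le \<longleftrightarrow>
     partial_order_on S le \<and> (\<forall>x\<in>S. \<forall>y\<in>S. \<exists>z\<in>S. (x, z) \<in> le \<and> (y, z) \<in> le)"

text \<open>A cardinal $\lambda$ is represented by a cardinal order \<open>\<kappa>\<close> (\<open>Card_order \<kappa>\<close>): the ordinals
  below $\lambda$ are the elements of \<open>Field \<kappa>\<close>, and those below a given \<open>\<gamma>\<close> are \<open>underS \<kappa> \<gamma>\<close>.\<close>

definition power_system ::
    "'s set \<Rightarrow> 's rel \<Rightarrow> 'l rel \<Rightarrow> ('l \<Rightarrow> 's, 'l \<Rightarrow> 's) relational_system" where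
  "power_system S le \<kappa> =
     \<lparr> rs_dom = Field \<kappa> \<rightarrow>\<^sub>E S, rs_cod = Field \<kappa> \<rightarrow>\<^sub>E S,
       rs_rel = {(X, Y). X \<in> Field \<kappa> \<rightarrow>\<^sub>E S \<and> Y \<in> Field \<kappa> \<rightarrow>\<^sub>E S \<and>
                         (\<forall>\<alpha>\<in>Field \<kappa>. (X \<alpha>, Y \<alpha>) \<in> le)} \<rparr>"

section \<open>Strong measure zero sets and Yorioka ideals\<close>

text \<open>The Cantor space $2^\omega$ is the type \<open>nat \<Rightarrow> bool\<close>, whose library topology is the product
  of the discrete topology on \<open>bool\<close>; elements of $2^{<\omega}$ are of type \<open>bool list\<close>.\<close>

definition cylinder :: "bool list \<Rightarrow> (nat \<Rightarrow> bool) set" where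
  "cylinder s = {x. \<forall>i<length s. s ! i = x i}"

definition strong_measure_zero :: "(nat \<Rightarrow> bool) set set" where
  "strong_measure_zero =
     {X. \<forall>f :: nat \<Rightarrow> nat. \<exists>\<sigma> :: nat \<Rightarrow> bool list.
           (\<forall>n. length (\<sigma> n) = f n) \<and> X \<subseteq> (\<Union>n. cylinder (\<sigma> n))}"

definition SN_system :: "((nat \<Rightarrow> bool) set, (nat \<Rightarrow> bool) set) relational_system" where
  "SN_system =
     \<lparr> rs_dom = strong_measure_zero, rs_cod = strong_measure_zero,
       rs_rel = {(X, Y). X \<in> strong_measure_zero \<and> Y \<in> strong_measure_zero \<and> X \<subseteq> Y} \<rparr>"

definition eventually_le :: "(nat \<Rightarrow> nat) \<Rightarrow> (nat \<Rightarrow> nat) \<Rightarrow> bool" (infix \<open>\<le>\<^sup>*\<close> 50) where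
  "f \<le>\<^sup>* g \<longleftrightarrow> (\<forall>\<^sub>F i in sequentially. f i \<le> g i)"

definition pw :: "nat \<Rightarrow> nat \<Rightarrow> nat" where
  "pw k i = i ^ k"

definition much_below :: "(nat \<Rightarrow> nat) \<Rightarrow> (nat \<Rightarrow> nat) \<Rightarrow> bool" (infix \<open>\<lless>\<close> 50) where
  "f \<lless> g \<longleftrightarrow> (\<forall>k. f \<circ> pw k \<le>\<^sup>* g)"

definition ht :: "(nat \<Rightarrow> bool list) \<Rightarrow> nat \<Rightarrow> nat" where
  "ht \<sigma> i = length (\<sigma> i)"

definition limsup_cylinders :: "(nat \<Rightarrow> bool list) \<Rightarrow> (nat \<Rightarrow> bool) set" where
  "limsup_cylinders \<sigma> = {x. \<exists>\<^sub>\<infinity>n. x \<in> cylinder (\<sigma> n)}"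

definition yorioka_ideal :: "(nat \<Rightarrow> nat) \<Rightarrow> (nat \<Rightarrow> bool) set set" where
  "yorioka_ideal f = {X. \<exists>\<sigma>. X \<subseteq> limsup_cylinders \<sigma> \<and> f \<lless> ht \<sigma>}"

section \<open>Directed and dominating systems\<close>

definition directed_system ::
    "(nat \<Rightarrow> nat) \<Rightarrow> 's set \<Rightarrow> 's rel \<Rightarrow> ('s \<Rightarrow> (nat \<Rightarrow> bool) set) \<Rightarrow> bool" where
  "directed_system f S le A \<longleftrightarrow>
     (\<forall>i\<in>S. closure (A i) = UNIV \<and> gdelta (A i) \<and> A i \<in> yorioka_ideal f) \<and>
     (\<forall>i\<in>S. \<forall>j\<in>S. (i, j) \<in> le \<longrightarrow> A i \<subseteq> A j) \<and>
     (\<forall>X\<in>yorioka_ideal f. \<exists>i\<in>S. X \<subseteq> A i)"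

definition dominating_family :: "(nat \<Rightarrow> nat) set \<Rightarrow> bool" where
  "dominating_family D \<longleftrightarrow> (\<forall>g. \<exists>f\<in>D. g \<le>\<^sup>* f)"

text \<open>``Increasing'' is read in the weak sense, \<open>mono\<close>; this admits more systems than the reading
  \<open>strict_mono\<close>.  For the least \<open>\<gamma>\<close> the intersection below is indexed by the empty set and
  equals \<open>UNIV\<close>.\<close>

definition dominating_system ::
    "'l rel \<Rightarrow> 's set \<Rightarrow> 's rel \<Rightarrow> 's \<Rightarrow> ('l \<Rightarrow> nat \<Rightarrow> nat) \<Rightarrow>
     ('l \<Rightarrow> 's \<Rightarrow> (nat \<Rightarrow> bool) set) \<Rightarrow> bool" where
  "dominating_system \<kappa> S le i\<^sub>0 f A \<longleftrightarrow>
     (\<forall>\<gamma>\<in>Field \<kappa>. mono (f \<gamma>)) \<and>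
     dominating_family (f ` Field \<kappa>) \<and>
     (\<forall>\<gamma>\<in>Field \<kappa>. directed_system (f \<gamma>) S le (A \<gamma>)) \<and>
     (\<forall>\<gamma>\<in>Field \<kappa>. (\<Inter>\<eta>\<in>underS \<kappa> \<gamma>. A \<eta> i\<^sub>0) \<notin> yorioka_ideal (f \<gamma>))"

end

(* A set has strong measure zero iff it lies in I_f for every f in a dominating family.
   Hence, for a dominating system A, send a strong measure zero set X to a choice of indices i(gamma)
   with X contained in A^gamma_i(gamma), and send Y to the intersection of all A^gamma_Y(gamma),
   which has strong measure zero. *)
theory Submission
  imports Defs
begin

text \<open>For fixed \<open>k\<close>, the bound \<open>i ^ k \<le> i ^ i\<close> holds as soon as
  \<open>i > k\<close>. A single height function thus eventually dominates all the
  \<open>f \<circ> pw k\<close> at once.\<close>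

lemma mono_much_below_diagonal:
  assumes "mono f"
  shows "f \<lless> (\<lambda>i. f (i ^ i))"
  unfolding much_below_def eventually_le_def eventually_sequentially
proof (intro allI exI impI)
  fix k i :: nat
  assume "Suc k \<le> i"
  then have "i ^ k \<le> i ^ i" by (intro power_increasing) auto
  then show "(f \<circ> pw k) i \<le> f (i ^ i)"
    using assms by (simp add: pw_def monoD)
qed

text \<open>This upgrades covering once to covering infinitely often, with heights still prescribed
  exactly: the index set splits into countably many infinite rows, and each row carries a cover of
  its own.\<close>

lemma strong_measure_zero_limsup_cover:
  assumes "X \<in> strong_measure_zero"
  obtains \<sigma> where "ht \<sigma> = g" "X \<subseteq> limsup_cylinders \<sigma>"
proof -
  \<comment> \<open>The definition is applied to the part of \<open>g\<close> on row
    \<open>m\<close>, the positions \<open>prod_encode (m, n)\<close>.\<close>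
  have "\<exists>\<tau>. (\<forall>n. length (\<tau> n) = g (prod_encode (m, n))) \<and> X \<subseteq> (\<Union>n. cylinder (\<tau> n))" for m
    using assms by (simp add: strong_measure_zero_def)
  then obtain \<tau> where len: "\<And>m n. length (\<tau> m n) = g (prod_encode (m, n))"
    and cov: "\<And>m. X \<subseteq> (\<Union>n. cylinder (\<tau> m n))"
    by metis
  \<comment> \<open>Interleaving one cover for each \<open>m\<close> covers every point infinitely often.\<close>
  define \<sigma> where "\<sigma> k = (case prod_decode k of (m, n) \<Rightarrow> \<tau> m n)" for k
  have "ht \<sigma> = g"
    by (simp add: fun_eq_iff ht_def \<sigma>_def case_prod_unfold len)
  moreover have "x \<in> limsup_cylinders \<sigma>" if "x \<in> X" for x
  proof -
    have "\<exists>n. x \<in> cylinder (\<sigma> (prod_encode (m, n)))" for m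
      using cov[of m] that by (auto simp: \<sigma>_def)
    \<comment> \<open>Every position in row \<open>m\<close> is at least \<open>m\<close>, so the
      hit in that row lies at or beyond \<open>m\<close>.\<close>
    then have "\<exists>k\<ge>m. x \<in> cylinder (\<sigma> k)" for m
      by (meson le_prod_encode_1)
    then show ?thesis
      by (simp add: limsup_cylinders_def INFM_nat_le)
  qed
  ultimately show ?thesis using that by blast
qed

lemma strong_measure_zero_subset_yorioka_ideal:
  assumes "mono f"
  shows "strong_measure_zero \<subseteq> yorioka_ideal f"
proof
  fix X assume "X \<in> strong_measure_zero"
  then obtain \<sigma> where "ht \<sigma> = (\<lambda>i. f (i ^ i))" "X \<subseteq> limsup_cylinders \<sigma>"
    by (rule strong_measure_zero_limsup_cover)
  then show "X \<in> yorioka_ideal f"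
    using mono_much_below_diagonal[OF assms] unfolding yorioka_ideal_def by auto
qed

lemma cylinder_take_superset: "cylinder s \<subseteq> cylinder (take n s)"
  by (auto simp: cylinder_def)

text \<open>The case \<open>k = 1\<close> of \<open>f \<lless> ht \<sigma>\<close>, for some
  \<open>f\<close> in \<open>D\<close> dominating the prescribed lengths, makes almost all strings
  long enough; truncating them only enlarges their cylinders.\<close>

lemma strong_measure_zero_if_in_yorioka_ideals:
  assumes "dominating_family D" and in_ideals: "\<And>f. f \<in> D \<Longrightarrow> X \<in> yorioka_ideal f"
  shows "X \<in> strong_measure_zero"
  unfolding strong_measure_zero_def
proof (intro CollectI allI)
  fix h :: "nat \<Rightarrow> nat"
  obtain f where "f \<in> D" "h \<le>\<^sup>* f"
    using assms(1) unfolding dominating_family_def by blast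
  from in_ideals[OF \<open>f \<in> D\<close>] obtain \<sigma> where X: "X \<subseteq> limsup_cylinders \<sigma>" and "f \<lless> ht \<sigma>"
    unfolding yorioka_ideal_def by blast
  from \<open>f \<lless> ht \<sigma>\<close> have "f \<circ> pw 1 \<le>\<^sup>* ht \<sigma>"
    unfolding much_below_def by blast
  with \<open>h \<le>\<^sup>* f\<close> have "\<forall>\<^sub>F i in sequentially. h i \<le> length (\<sigma> i)"
    unfolding eventually_le_def by eventually_elim (simp add: pw_def ht_def)
  then obtain N where N: "\<And>i. i \<ge> N \<Longrightarrow> h i \<le> length (\<sigma> i)"
    unfolding eventually_sequentially by blast
  \<comment> \<open>Below \<open>N\<close> the string \<open>\<sigma> n\<close> may be too short, so
    an arbitrary string of the right length stands in. No point is lost, since each is caught at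
    some index from \<open>N\<close> on.\<close>
  define \<tau> where "\<tau> n = (if n \<ge> N then take (h n) (\<sigma> n) else replicate (h n) False)" for n
  have "length (\<tau> n) = h n" for n
    using N by (simp add: \<tau>_def)
  moreover have "x \<in> (\<Union>n. cylinder (\<tau> n))" if "x \<in> X" for x
  proof -
    from X that obtain n where "n \<ge> N" "x \<in> cylinder (\<sigma> n)"
      unfolding limsup_cylinders_def INFM_nat_le by blast
    then have "x \<in> cylinder (\<tau> n)"
      using cylinder_take_superset by (auto simp: \<tau>_def)
    then show ?thesis by blast
  qed
  ultimately show "\<exists>\<tau>. (\<forall>n. length (\<tau> n) = h n) \<and> X \<subseteq> (\<Union>n. cylinder (\<tau> n))"
    by blast
qed

lemma yorioka_ideal_subset:
  "X \<in> yorioka_ideal f \<Longrightarrow> Y \<subseteq> X \<Longrightarrow> Y \<in> yorioka_ideal f"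
  unfolding yorioka_ideal_def by blast

theorem theorem3p6:
  fixes S :: "'s set" and le :: "'s rel" and i\<^sub>0 :: 's and \<kappa> :: "'l rel"
  assumes "directed_partial_order S le"
    and "i\<^sub>0 \<in> S" and "\<forall>i\<in>S. (i\<^sub>0, i) \<in> le"
    and "Card_order \<kappa>"
    and "\<exists>(f :: 'l \<Rightarrow> nat \<Rightarrow> nat) (A :: 'l \<Rightarrow> 's \<Rightarrow> (nat \<Rightarrow> bool) set). dominating_system \<kappa> S le i\<^sub>0 f A"
  shows "SN_system \<preceq>\<^sub>T power_system S le \<kappa>"
proof -
  obtain f :: "'l \<Rightarrow> nat \<Rightarrow> nat" and A :: "'l \<Rightarrow> 's \<Rightarrow> (nat \<Rightarrow> bool) set"
    where "dominating_system \<kappa> S le i\<^sub>0 f A"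
    using assms(5) by blast
  then have mono: "\<And>\<gamma>. \<gamma> \<in> Field \<kappa> \<Longrightarrow> mono (f \<gamma>)"
    and dom: "dominating_family (f ` Field \<kappa>)"
    and dir: "\<And>\<gamma>. \<gamma> \<in> Field \<kappa> \<Longrightarrow> directed_system (f \<gamma>) S le (A \<gamma>)"
    unfolding dominating_system_def by blast+
  \<comment> \<open>The restriction to \<open>Field \<kappa>\<close> makes the function
    \<open>undefined\<close> elsewhere, as membership in the extensional product requires.\<close>
  define \<Psi>1 where "\<Psi>1 X = (\<lambda>\<gamma>\<in>Field \<kappa>. SOME i. i \<in> S \<and> X \<subseteq> A \<gamma> i)" for X
  define \<Psi>2 where "\<Psi>2 Y = (\<Inter>\<gamma>\<in>Field \<kappa>. A \<gamma> (Y \<gamma>))" for Y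
  have \<Psi>1: "\<Psi>1 X \<gamma> \<in> S \<and> X \<subseteq> A \<gamma> (\<Psi>1 X \<gamma>)"
    if "X \<in> strong_measure_zero" "\<gamma> \<in> Field \<kappa>" for X \<gamma>
  proof -
    have "X \<in> yorioka_ideal (f \<gamma>)"
      using strong_measure_zero_subset_yorioka_ideal[OF mono] that by blast
    \<comment> \<open>Cofinality of the system in the ideal justifies the choice in
      \<open>\<Psi>1\<close>.\<close>
    then have "\<exists>i. i \<in> S \<and> X \<subseteq> A \<gamma> i"
      using dir[OF that(2)] unfolding directed_system_def by blast
    from someI_ex[OF this] show ?thesis
      using that(2) by (simp add: \<Psi>1_def)
  qed
  then have \<Psi>1_dom: "\<Psi>1 X \<in> Field \<kappa> \<rightarrow>\<^sub>E S" if "X \<in> strong_measure_zero" for X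
    using that by (auto simp: PiE_iff extensional_def) (simp add: \<Psi>1_def)
  have \<Psi>2: "\<Psi>2 Y \<in> strong_measure_zero" if "Y \<in> Field \<kappa> \<rightarrow>\<^sub>E S" for Y
  proof (rule strong_measure_zero_if_in_yorioka_ideals[OF dom])
    fix g assume "g \<in> f ` Field \<kappa>"
    then obtain \<gamma> where \<gamma>: "\<gamma> \<in> Field \<kappa>" "g = f \<gamma>" by blast
    have "Y \<gamma> \<in> S" using that \<gamma>(1) by (rule PiE_mem)
    then have "A \<gamma> (Y \<gamma>) \<in> yorioka_ideal g"
      using dir[OF \<gamma>(1)] \<gamma>(2) by (simp add: directed_system_def)
    then show "\<Psi>2 Y \<in> yorioka_ideal g"
      by (rule yorioka_ideal_subset) (use \<gamma>(1) in \<open>auto simp: \<Psi>2_def\<close>)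
  qed
  have "X \<subseteq> \<Psi>2 Y"
    if X: "X \<in> strong_measure_zero" and Y: "Y \<in> Field \<kappa> \<rightarrow>\<^sub>E S"
      and le: "\<forall>\<gamma>\<in>Field \<kappa>. (\<Psi>1 X \<gamma>, Y \<gamma>) \<in> le" for X Y
    unfolding \<Psi>2_def
  proof (rule INT_greatest)
    fix \<gamma> assume \<gamma>: "\<gamma> \<in> Field \<kappa>"
    have "Y \<gamma> \<in> S" using Y \<gamma> by (rule PiE_mem)
    \<comment> \<open>The pointwise order of indices becomes inclusion by monotonicity of the system
      \<open>A \<gamma>\<close>.\<close>
    then have "A \<gamma> (\<Psi>1 X \<gamma>) \<subseteq> A \<gamma> (Y \<gamma>)"
      using dir[OF \<gamma>] \<Psi>1[OF X \<gamma>] le \<gamma> by (simp add: directed_system_def)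
    then show "X \<subseteq> A \<gamma> (Y \<gamma>)"
      using \<Psi>1[OF X \<gamma>] by blast
  qed
  then show ?thesis
    unfolding tukey_below_def SN_system_def power_system_def
    using \<Psi>1_dom \<Psi>2 by (intro exI[of _ \<Psi>1] exI[of _ \<Psi>2]) auto
qed

end
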